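(* Let $m_{00},m_{11},m_{22},m_{33}$ be the diagonal elements, in the ordered basis $|00\rangle,|01\rangle,|10\rangle,|11\rangle$, of some two-qubit state $\rho_{AB}$, and let $e_x=\mathrm{Tr}(\Pi_x^-\rho_{AB})$, $e_y=\mathrm{Tr}(\Pi_y^-\rho_{AB})$, $e_z=m_{11}+m_{22}$. Let $K_{six}^{opt}=C(\tau)-H(e_z)$ with $$\tau=\begin{pmatrix}m_{00}&0&0&(1-e_x-e_y)/2\\0&m_{11}&(e_y-e_x)/2&0\\0&(e_y-e_x)/2&m_{22}&0\\(1-e_x-e_y)/2&0&0&m_{33}\end{pmatrix},$$ and let $K_{six}=1-H(\{p_i\})$, where $p_0,p_1,p_2,p_3$ are determined by $\sum_ip_i=1$, $e_x=p_1+p_3$, $e_y=p_1+p_2$, $e_z=p_2+p_3$. Then $$K_{six}^{opt}\ge K_{six}.$$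
   Context: Logarithms are base 2; $S(\rho)=-\mathrm{Tr}[\rho\log_2\rho]$; $H(e)=-e\log_2e-(1-e)\log_2(1-e)$ for a number $e$, and $H(\{p_i\})=-\sum_ip_i\log_2p_i$. $|\pm\rangle=(|0\rangle\pm|1\rangle)/\sqrt2$, $|\pm i\rangle=(|0\rangle\pm i|1\rangle)/\sqrt2$, $\Pi_x^-=|{+-}\rangle\langle{+-}|+|{-+}\rangle\langle{-+}|$, $\Pi_y^-=|{+i},{+i}\rangle\langle{+i},{+i}|+|{-i},{-i}\rangle\langle{-i},{-i}|$. $C(\rho)=S(\rho^{\mathrm{diag}})-S(\rho)$ is the relative entropy of coherence in the reference basis $\{|00\rangle,|01\rangle,|10\rangle,|11\rangle\}$, with $\rho^{\mathrm{diag}}$ the diagonal part of $\rho$ in that basis. The numbers $p_i$ are the diagonal elements of $\rho_{AB}$ in the Bell basis $|\Phi^+\rangle,|\Phi^-\rangle,|\Psi^+\rangle,|\Psi^-\rangle$, where $|\Phi^{\pm}\rangle=(|00\rangle\pm|11\rangle)/\sqrt2$ and $|\Psi^{\pm}\rangle=(|01\rangle\pm|10\rangle)/\sqrt2$. $K_{six}$ is the original key rate of the six-state protocol; $K_{six}^{opt}$ is the key rate obtained from the fine-grained parameters. *)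

theory Defs
  imports "Jordan_Normal_Form.Schur_Decomposition"
begin

definition mat_trace :: "complex mat \<Rightarrow> complex" where
  "mat_trace A = (\<Sum>i<dim_row A. A $$ (i, i))"

definition unitary_mat :: "nat \<Rightarrow> complex mat \<Rightarrow> bool" where
  "unitary_mat n U \<longleftrightarrow> U \<in> carrier_mat n n \<and> mat_adjoint U * U = 1\<^sub>m n \<and> U * mat_adjoint U = 1\<^sub>m n"

definition hermitian_mat :: "nat \<Rightarrow> complex mat \<Rightarrow> bool" where
  "hermitian_mat n A \<longleftrightarrow> A \<in> carrier_mat n n \<and> mat_adjoint A = A"

text \<open>
  The inner product \<open>\<bullet>c\<close> conjugates its second argument, so \<open>(A *\<^sub>v v) \<bullet>c v\<close>
  is the expectation value of \<open>A\<close> in \<open>v\<close>.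
\<close>
definition density_mat :: "nat \<Rightarrow> complex mat \<Rightarrow> bool" where
  "density_mat n \<rho> \<longleftrightarrow> hermitian_mat n \<rho> \<and>
     (\<forall>v \<in> carrier_vec n. 0 \<le> Re ((\<rho> *\<^sub>v v) \<bullet>c v)) \<and> mat_trace \<rho> = 1"

text \<open>
  Functional calculus: \<open>spectral_form f A B\<close> holds if \<open>A = U D U\<^sup>*\<close> and \<open>B = U (f D) U\<^sup>*\<close>
  with \<open>U\<close> unitary and \<open>D\<close> real diagonal.  The matrix \<open>B\<close> does not depend on the chosen
  diagonalization (see \<open>mat_fun_eq\<close> below), so that \<open>mat_fun f A\<close> is \<open>f(A)\<close> for Hermitian \<open>A\<close>.
\<close>
definition spectral_form :: "(real \<Rightarrow> real) \<Rightarrow> complex mat \<Rightarrow> complex mat \<Rightarrow> bool" where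
  "spectral_form f A B \<longleftrightarrow> (\<exists>U d. unitary_mat (dim_row A) U \<and>
     A = U * mat_diag (dim_row A) (\<lambda>i. complex_of_real (d i)) * mat_adjoint U \<and>
     B = U * mat_diag (dim_row A) (\<lambda>i. complex_of_real (f (d i))) * mat_adjoint U)"

definition mat_fun :: "(real \<Rightarrow> real) \<Rightarrow> complex mat \<Rightarrow> complex mat" where
  "mat_fun f A = (THE B. spectral_form f A B)"

lemma mat_adjoint_carrier: "U \<in> carrier_mat n n \<Longrightarrow> mat_adjoint U \<in> carrier_mat n n"
  unfolding mat_adjoint_def by (rule carrier_matI) simp_all

lemma spectral_form_unique:
  assumes "spectral_form f A B" "spectral_form f A C"
  shows "B = C"
proof -
  define n where "n = dim_row A"
  from assms(1) obtain U d where U: "unitary_mat n U"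
    and AU: "A = U * mat_diag n (\<lambda>i. complex_of_real (d i)) * mat_adjoint U"
    and BU: "B = U * mat_diag n (\<lambda>i. complex_of_real (f (d i))) * mat_adjoint U"
    unfolding spectral_form_def n_def by blast
  from assms(2) obtain V e where V: "unitary_mat n V"
    and AV: "A = V * mat_diag n (\<lambda>i. complex_of_real (e i)) * mat_adjoint V"
    and CV: "C = V * mat_diag n (\<lambda>i. complex_of_real (f (e i))) * mat_adjoint V"
    unfolding spectral_form_def n_def by blast
  let ?U' = "mat_adjoint U" and ?V' = "mat_adjoint V"
  let ?D = "mat_diag n (\<lambda>i. complex_of_real (d i))"
  let ?E = "mat_diag n (\<lambda>i. complex_of_real (e i))"
  let ?fD = "mat_diag n (\<lambda>i. complex_of_real (f (d i)))"
  let ?fE = "mat_diag n (\<lambda>i. complex_of_real (f (e i)))"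
  have c: "U \<in> carrier_mat n n" "V \<in> carrier_mat n n"
    "?U' \<in> carrier_mat n n" "?V' \<in> carrier_mat n n"
    using U V mat_adjoint_carrier unfolding unitary_mat_def by auto
  have dc: "mat_diag n g \<in> carrier_mat n n" for g :: "nat \<Rightarrow> complex" by simp
  have u: "?U' * U = 1\<^sub>m n" "U * ?U' = 1\<^sub>m n" "?V' * V = 1\<^sub>m n" "V * ?V' = 1\<^sub>m n"
    using U V unfolding unitary_mat_def by auto
  define W where "W = ?V' * U"
  have W: "W \<in> carrier_mat n n" unfolding W_def using c by auto
  have conj: "?V' * (U * G * ?U') * U = W * G" if G: "G \<in> carrier_mat n n" for G
  proof -
    have "?V' * (U * G * ?U') * U = ?V' * (U * G * (?U' * U))"
      using c G by (simp add: assoc_mult_mat[of _ n n _ n _ n])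
    also have "\<dots> = W * G"
      unfolding u W_def using c G by (simp add: assoc_mult_mat[of _ n n _ n _ n])
    finally show ?thesis .
  qed
  have conj': "?V' * (V * G * ?V') * U = G * W" if G: "G \<in> carrier_mat n n" for G
  proof -
    have "?V' * (V * G * ?V') * U = (?V' * V) * (G * W)"
      unfolding W_def using c G by (simp add: assoc_mult_mat[of _ n n _ n _ n])
    also have "\<dots> = G * W"
      unfolding u using W G by simp
    finally show ?thesis .
  qed
  have "W * ?D = ?E * W"
  proof -
    have "W * ?D = ?V' * A * U" unfolding AU by (rule conj[OF dc, symmetric])
    also have "\<dots> = ?E * W" unfolding AV by (rule conj'[OF dc])
    finally show ?thesis .
  qed
  hence *: "(W * ?D) $$ (i, j) = (?E * W) $$ (i, j)" for i j by simp
  have eq: "W $$ (i, j) * d j = e i * W $$ (i, j)" if "i < n" "j < n" for i j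
    using *[of i j] that
    unfolding mat_diag_mult_left[OF W] mat_diag_mult_right[OF W] by simp
  have "W * ?fD = ?fE * W"
    unfolding mat_diag_mult_left[OF W] mat_diag_mult_right[OF W]
  proof (rule eq_matI, goal_cases)
    case (1 i j)
    thus ?case using eq[of i j] by (cases "W $$ (i, j) = 0") simp_all
  qed simp_all
  hence "?V' * B * U = ?V' * C * U"
    unfolding BU CV conj[OF dc] conj'[OF dc] by simp
  hence *: "V * (?V' * B * U) * ?U' = V * (?V' * C * U) * ?U'" by simp
  have "V * (?V' * X * U) * ?U' = X" if X: "X \<in> carrier_mat n n" for X
  proof -
    have "V * (?V' * X * U) * ?U' = (V * ?V') * X * (U * ?U')"
      using c X by (simp add: assoc_mult_mat[of _ n n _ n _ n])
    also have "\<dots> = X" unfolding u using X by simp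
    finally show ?thesis .
  qed
  moreover have "B \<in> carrier_mat n n" "C \<in> carrier_mat n n"
    unfolding BU CV using c by auto
  ultimately show ?thesis using * by simp
qed

lemma mat_fun_eq: "spectral_form f A B \<Longrightarrow> mat_fun f A = B"
  unfolding mat_fun_def by (rule the_equality) (assumption, rule spectral_form_unique)

text \<open>
  Since \<open>ln 0 = 0\<close>, \<open>mat_fun (log 2) \<rho>\<close> vanishes on the kernel of \<open>\<rho>\<close> and all the
  definitions below follow the convention \<open>0 log 0 = 0\<close>.
\<close>
definition vn_entropy :: "complex mat \<Rightarrow> real" where
  "vn_entropy \<rho> = - Re (mat_trace (\<rho> * mat_fun (log 2) \<rho>))"

definition diag_part :: "complex mat \<Rightarrow> complex mat" where
  "diag_part \<rho> = mat_diag (dim_row \<rho>) (\<lambda>i. \<rho> $$ (i, i))"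

definition coherence :: "complex mat \<Rightarrow> real" where
  "coherence \<rho> = vn_entropy (diag_part \<rho>) - vn_entropy \<rho>"

definition binary_entropy :: "real \<Rightarrow> real" where
  "binary_entropy e = - e * log 2 e - (1 - e) * log 2 (1 - e)"

definition shannon_entropy :: "nat \<Rightarrow> (nat \<Rightarrow> real) \<Rightarrow> real" where
  "shannon_entropy n p = - (\<Sum>i<n. p i * log 2 (p i))"

text \<open>
  The product \<open>|a\<rangle> \<otimes> |b\<rangle>\<close> of two qubit basis vectors is the basis vector with index \<open>2 a + b\<close>.
\<close>
definition tensor_vec :: "complex vec \<Rightarrow> complex vec \<Rightarrow> complex vec" (infixl "\<otimes>\<^sub>v" 70) where
  "u \<otimes>\<^sub>v v = vec (dim_vec u * dim_vec v) (\<lambda>i. u $ (i div dim_vec v) * v $ (i mod dim_vec v))"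

definition proj :: "complex vec \<Rightarrow> complex mat" where
  "proj v = mat (dim_vec v) (dim_vec v) (\<lambda>(i, j). v $ i * cnj (v $ j))"

definition ket0 :: "complex vec" where "ket0 = unit_vec 2 0"
definition ket1 :: "complex vec" where "ket1 = unit_vec 2 1"

definition ket_plus :: "complex vec" where
  "ket_plus = complex_of_real (1 / sqrt 2) \<cdot>\<^sub>v (ket0 + ket1)"
definition ket_minus :: "complex vec" where
  "ket_minus = complex_of_real (1 / sqrt 2) \<cdot>\<^sub>v (ket0 - ket1)"
definition ket_plus_i :: "complex vec" where
  "ket_plus_i = complex_of_real (1 / sqrt 2) \<cdot>\<^sub>v (ket0 + \<i> \<cdot>\<^sub>v ket1)"
definition ket_minus_i :: "complex vec" where
  "ket_minus_i = complex_of_real (1 / sqrt 2) \<cdot>\<^sub>v (ket0 - \<i> \<cdot>\<^sub>v ket1)"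

definition Pi_x_minus :: "complex mat" where
  "Pi_x_minus = proj (ket_plus \<otimes>\<^sub>v ket_minus) + proj (ket_minus \<otimes>\<^sub>v ket_plus)"

definition Pi_y_minus :: "complex mat" where
  "Pi_y_minus = proj (ket_plus_i \<otimes>\<^sub>v ket_plus_i) + proj (ket_minus_i \<otimes>\<^sub>v ket_minus_i)"

text \<open>The Bell basis in the order \<open>\<Phi>\<^sup>+, \<Phi>\<^sup>-, \<Psi>\<^sup>+, \<Psi>\<^sup>-\<close>.\<close>
definition bell_vec :: "nat \<Rightarrow> complex vec" where
  "bell_vec i = complex_of_real (1 / sqrt 2) \<cdot>\<^sub>v
     [ket0 \<otimes>\<^sub>v ket0 + ket1 \<otimes>\<^sub>v ket1, ket0 \<otimes>\<^sub>v ket0 - ket1 \<otimes>\<^sub>v ket1,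
      ket0 \<otimes>\<^sub>v ket1 + ket1 \<otimes>\<^sub>v ket0, ket0 \<otimes>\<^sub>v ket1 - ket1 \<otimes>\<^sub>v ket0] ! i"

definition K_six :: "(nat \<Rightarrow> real) \<Rightarrow> real" where
  "K_six p = 1 - shannon_entropy 4 p"

definition tau :: "real \<Rightarrow> real \<Rightarrow> real \<Rightarrow> real \<Rightarrow> real \<Rightarrow> real \<Rightarrow> complex mat" where
  "tau m00 m11 m22 m33 ex ey = mat_of_rows_list 4 (map (map complex_of_real)
    [[m00, 0, 0, (1 - ex - ey) / 2],
     [0, m11, (ey - ex) / 2, 0],
     [0, (ey - ex) / 2, m22, 0],
     [(1 - ex - ey) / 2, 0, 0, m33]])"

definition K_six_opt :: "real \<Rightarrow> real \<Rightarrow> real \<Rightarrow> real \<Rightarrow> real \<Rightarrow> real \<Rightarrow> real \<Rightarrow> real" where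
  "K_six_opt m00 m11 m22 m33 ex ey ez =
     coherence (tau m00 m11 m22 m33 ex ey) - binary_entropy ez"

lemma sum4: "(\<Sum>i<4. f i) = f 0 + f 1 + f 2 + (f (3::nat) :: 'a :: comm_monoid_add)"
  by (simp add: eval_nat_numeral)

lemma mat_trace_mult_4:
  assumes "A \<in> carrier_mat 4 4" "B \<in> carrier_mat 4 4"
  shows "mat_trace (A * B) = (\<Sum>i<4. \<Sum>j<4. A $$ (i, j) * B $$ (j, i))"
  using assms unfolding mat_trace_def
  by (auto simp: scalar_prod_def lessThan_atLeast0 intro!: sum.cong)

lemma less_4_cases: "(i::nat) < 4 \<longleftrightarrow> i = 0 \<or> i = 1 \<or> i = 2 \<or> i = 3" by auto

lemma half: "inverse (complex_of_real (sqrt 2)) * inverse (complex_of_real (sqrt 2)) = 1/2"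
  by (simp flip: of_real_mult add: field_simps)

lemma kets:
  defines "c \<equiv> inverse (complex_of_real (sqrt 2))"
  shows "ket_plus = vec_of_list [c, c]" "ket_minus = vec_of_list [c, -c]"
    "ket_plus_i = vec_of_list [c, c*\<i>]" "ket_minus_i = vec_of_list [c, -(c*\<i>)]"
    "ket0 = vec_of_list [1,0]" "ket1 = vec_of_list [0,1]"
  unfolding c_def ket_plus_def ket_minus_def ket_plus_i_def ket_minus_i_def ket0_def ket1_def
  by (auto intro!: eq_vecI simp: less_Suc_eq unit_vec_def field_simps)

lemma tensor2: "vec_of_list [a,b] \<otimes>\<^sub>v vec_of_list [c,d] = vec_of_list [a*c,a*d,b*c,b*d]"
proof -
  have "(vec_of_list [a,b] \<otimes>\<^sub>v vec_of_list [c,d]) $ i = vec_of_list [a*c,a*d,b*c,b*d] $ i"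
    if "i < 4" for i
  proof -
    have l: "length [x,y] = 2" for x y :: complex by simp
    have "(vec_of_list [a,b] \<otimes>\<^sub>v vec_of_list [c,d]) $ i = [a,b] ! (i div 2) * [c,d] ! (i mod 2)"
      unfolding tensor_vec_def dim_vec_of_list vec_of_list_index l using that by simp
    also have "\<dots> = [a*c,a*d,b*c,b*d] ! i"
      using that unfolding less_4_cases by auto
    finally show ?thesis by (simp only: vec_of_list_index)
  qed
  thus ?thesis by (intro eq_vecI) (simp_all add: tensor_vec_def)
qed

lemma proj_list: "i < length xs \<Longrightarrow> j < length xs \<Longrightarrow> proj (vec_of_list xs) $$ (i, j) = xs ! i * cnj (xs ! j)"
  "dim_row (proj (vec_of_list xs)) = length xs" "dim_col (proj (vec_of_list xs)) = length xs"
  unfolding proj_def by (simp_all add: vec_of_list_index)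

lemma trace_proj:
  assumes "A \<in> carrier_mat 4 4" "length xs = 4" "length ys = 4"
  shows "mat_trace ((proj (vec_of_list xs) + proj (vec_of_list ys)) * A) = (\<Sum>i<4. \<Sum>j<4. (xs ! i * cnj (xs ! j) + ys ! i * cnj (ys ! j)) * A $$ (j, i))"
  using assms by (subst mat_trace_mult_4) (auto simp: proj_list intro!: sum.cong carrier_matI)

lemma bell:
  defines "c \<equiv> inverse (complex_of_real (sqrt 2))"
  assumes "i < 4"
  shows "bell_vec i = vec_of_list ([[c,0,0,c],[c,0,0,-c],[0,c,c,0],[0,c,-c,0]] ! i)"
  using assms(2) unfolding bell_vec_def kets tensor2 less_4_cases c_def
  by (auto intro!: eq_vecI simp: less_Suc_eq field_simps)

lemma expect_list:
  assumes "A \<in> carrier_mat 4 4" "length xs = 4"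
  shows "(A *\<^sub>v vec_of_list xs) \<bullet>c vec_of_list xs = (\<Sum>i<4. \<Sum>j<4. A $$ (i, j) * xs ! j * cnj (xs ! i))"
  using assms by (auto simp: scalar_prod_def lessThan_atLeast0 vec_of_list_index sum_distrib_right intro!: sum.cong)

text \<open>
  The linear equations for the \<open>p i\<close> have a unique solution, the diagonal of the state in
  the Bell basis.
\<close>
lemma bell_diagonal:
  assumes "density_mat 4 \<rho>"
    and "complex_of_real m11 = \<rho> $$ (1, 1)" "complex_of_real m22 = \<rho> $$ (2, 2)"
    and "complex_of_real ex = mat_trace (Pi_x_minus * \<rho>)"
    and "complex_of_real ey = mat_trace (Pi_y_minus * \<rho>)"
    and "ez = m11 + m22"
    and "(\<Sum>i<4. p i) = 1" "ex = p 1 + p 3" "ey = p 1 + p 2" "ez = p 2 + p 3"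
    and "i < 4"
  shows "complex_of_real (p i) = (\<rho> *\<^sub>v bell_vec i) \<bullet>c bell_vec i"
proof -
  let ?r = "\<lambda>i j. \<rho> $$ (i, j)"
  define c where "c = inverse (complex_of_real (sqrt 2))"
  have cc: "c * c = 1/2" "cnj c = c" unfolding c_def using half by simp_all
  have cc': "c * (c * z) = z / 2" "c * (z * c) = z / 2" for z
    using arg_cong[OF cc(1), of "\<lambda>x. x * z"] by (simp_all add: mult_ac)
  have \<rho>: "\<rho> \<in> carrier_mat 4 4" and "mat_trace \<rho> = 1"
    using assms(1) unfolding density_mat_def hermitian_mat_def by auto
  hence tr: "?r 0 0 + ?r 1 1 + ?r 2 2 + ?r 3 3 = 1"
    unfolding mat_trace_def by (simp add: sum4)
  have r33: "?r 3 3 = 1 - ?r 0 0 - ?r 1 1 - ?r 2 2"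
    unfolding tr[symmetric] by simp
  note [simp] = sum4 cc cc' r33
  have ex: "complex_of_real ex = (1 - ?r 0 3 - ?r 3 0 - ?r 1 2 - ?r 2 1) / 2"
    unfolding assms(4) Pi_x_minus_def kets tensor2 c_def[symmetric]
    by (subst trace_proj[OF \<rho>]) (simp_all add: field_simps)
  have ey: "complex_of_real ey = (1 - ?r 0 3 - ?r 3 0 + ?r 1 2 + ?r 2 1) / 2"
    unfolding assms(5) Pi_y_minus_def kets tensor2 c_def[symmetric]
    by (subst trace_proj[OF \<rho>]) (simp_all add: field_simps)
  have p_eqs: "p 0 = 1 - (ex + ey + (m11 + m22)) / 2" "p 1 = (ex + ey - (m11 + m22)) / 2"
    "p 2 = (ey + (m11 + m22) - ex) / 2" "p 3 = (ex + (m11 + m22) - ey) / 2"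
    using assms(6-10) unfolding sum4 by argo+
  have p: "complex_of_real (p 0) = 1 - (ex + ey + (?r 1 1 + ?r 2 2)) / 2"
    "complex_of_real (p 1) = (ex + ey - (?r 1 1 + ?r 2 2)) / 2"
    "complex_of_real (p 2) = (ey + (?r 1 1 + ?r 2 2) - ex) / 2"
    "complex_of_real (p 3) = (ex + (?r 1 1 + ?r 2 2) - ey) / 2"
    unfolding assms(2,3)[symmetric] p_eqs by simp_all
  have b: "bell_vec 0 = vec_of_list [c, 0, 0, c]" "bell_vec 1 = vec_of_list [c, 0, 0, -c]"
    "bell_vec 2 = vec_of_list [0, c, c, 0]" "bell_vec 3 = vec_of_list [0, c, -c, 0]"
    using bell[of 0] bell[of 1] bell[of 2] bell[of 3] unfolding c_def by simp_all
  have "(\<rho> *\<^sub>v bell_vec 0) \<bullet>c bell_vec 0 = p 0"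
    unfolding b p by (subst expect_list[OF \<rho>]) (simp_all add: ex ey field_simps)
  moreover have "(\<rho> *\<^sub>v bell_vec 1) \<bullet>c bell_vec 1 = p 1"
    unfolding b p by (subst expect_list[OF \<rho>]) (simp_all add: ex ey field_simps)
  moreover have "(\<rho> *\<^sub>v bell_vec 2) \<bullet>c bell_vec 2 = p 2"
    unfolding b p by (subst expect_list[OF \<rho>]) (simp_all add: ex ey field_simps)
  moreover have "(\<rho> *\<^sub>v bell_vec 3) \<bullet>c bell_vec 3 = p 3"
    unfolding b p by (subst expect_list[OF \<rho>]) (simp_all add: ex ey field_simps)
  ultimately show ?thesis
    using \<open>i < 4\<close> unfolding less_4_cases by (elim disjE) (simp_all only:)
qed

end

theory Submission
  imports Defs "HOL-Real_Asymp.Real_Asymp"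
begin

text \<open>
  The matrix \<open>\<tau>\<close> is a direct sum of two real symmetric \<open>2 \<times> 2\<close> blocks, so it suffices to compare the
  two rates block by block.  Normalise a block with diagonal \<open>a, d\<close> and off-diagonal entry \<open>k\<close> to
  trace 1 and write \<open>z = a - d\<close>, \<open>x = 2 k\<close>: its diagonal is \<open>(1 \<plusminus> z)/2\<close>, its spectrum is
  \<open>(1 \<plusminus> sqrt (x\<^sup>2 + z\<^sup>2))/2\<close>, and the \<open>p i\<close> belonging to it are \<open>(1 \<plusminus> x)/2\<close>.  With \<open>f\<close> the
  entropy deficit of the distribution \<open>(1 \<plusminus> x)/2\<close>, the claim becomes
  \<open>f x + f z \<le> f (sqrt (x\<^sup>2 + z\<^sup>2))\<close>.  It holds at \<open>x = 0\<close>, and its derivative in \<open>x\<close> has the right sign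
  because \<open>f' x / x\<close> is increasing.  Positivity of the state provides \<open>k\<^sup>2 \<le> a d\<close>, that is
  \<open>x\<^sup>2 + z\<^sup>2 \<le> 1\<close>.
\<close>

section \<open>Calculus of the binary entropy deficit\<close>

text \<open>
  Twice the amount, in nats, by which the entropy of \<open>((1 + x)/2, (1 - x)/2)\<close> falls short of \<open>ln 2\<close>.
\<close>
definition binary_deficit :: "real \<Rightarrow> real" where
  "binary_deficit x = (1 + x) * ln (1 + x) + (1 - x) * ln (1 - x)"

text \<open>With \<open>ln 0 = 0\<close> the value at 0 is the limit of \<open>x * ln x\<close>. The
  endpoint matters because a block of rank one has radius 1, where one of the two weights
  vanishes.\<close>

lemma continuous_on_x_ln_x: "continuous_on {0..} (\<lambda>x::real. x * ln x)"
proof (rule continuous_on_eq_continuous_within[THEN iffD2], rule ballI)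
  fix x :: real
  assume "x \<in> {0..}"
  have "((\<lambda>x::real. x * ln x) \<longlongrightarrow> 0) (at_right 0)"
    by real_asymp
  moreover have "at_right (0::real) = at 0 within {0..}"
    by (rule at_within_nhd[of _ UNIV]) auto
  ultimately show "continuous (at x within {0..}) (\<lambda>x. x * ln x)"
    using \<open>x \<in> {0..}\<close>
    by (cases "x = 0") (auto simp: continuous_within intro!: tendsto_intros)
qed

lemma continuous_on_binary_deficit: "continuous_on {-1..1} binary_deficit"
  unfolding binary_deficit_def
  by (intro continuous_on_add continuous_on_compose2[OF continuous_on_x_ln_x] continuous_intros) auto

lemma has_real_derivative_binary_deficit:
  assumes "-1 < x" "x < 1"
  shows "(binary_deficit has_real_derivative ln ((1 + x) / (1 - x))) (at x)"
proof (rule DERIV_cong)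
  show "(binary_deficit has_real_derivative
      1 * ln (1 + x) + 1 / (1 + x) * (1 + x) + ((-1) * ln (1 - x) + (-1) / (1 - x) * (1 - x))) (at x)"
    unfolding binary_deficit_def[abs_def] using assms
    by (intro DERIV_add DERIV_mult) (auto intro!: derivative_eq_intros)
  show "1 * ln (1 + x) + 1 / (1 + x) * (1 + x) + ((-1) * ln (1 - x) + (-1) / (1 - x) * (1 - x))
      = ln ((1 + x) / (1 - x))"
    using assms by (simp add: ln_div)
qed

lemma has_real_derivative_ln_ratio:
  fixes y :: real
  assumes "-1 < y" "y < 1"
  shows "((\<lambda>x. ln ((1 + x) / (1 - x))) has_real_derivative 2 / (1 - y\<^sup>2)) (at y)"
proof (rule DERIV_cong)
  show "((\<lambda>x. ln ((1 + x) / (1 - x))) has_real_derivative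
      ((1 - y) - (1 + y) * (-1)) / (1 - y)\<^sup>2 / ((1 + y) / (1 - y))) (at y)"
    using assms by (auto intro!: derivative_eq_intros simp: power2_eq_square mult_ac)
  have *: "1 - y\<^sup>2 = (1 + y) * (1 - y)" "(1 - y) - (1 + y) * (-1) = 2"
    by (simp_all add: power2_eq_square algebra_simps)
  have **: "2 / u\<^sup>2 / (v / u) = 2 / (v * u)" if "u \<noteq> 0" "v \<noteq> 0" for u v :: real
    using that by (simp add: field_simps power2_eq_square)
  show "((1 - y) - (1 + y) * (-1)) / (1 - y)\<^sup>2 / ((1 + y) / (1 - y)) = 2 / (1 - y\<^sup>2)"
    unfolding * using assms by (intro **) simp_all
qed

text \<open>The difference of the two sides vanishes at 0 and has derivative
  \<open>4 * y\<^sup>2 / (1 - y\<^sup>2)\<^sup>2\<close>. The bound supplies the sign in the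
  quotient rule for \<open>ln_ratio_quotient_mono\<close>.\<close>

lemma ln_ratio_le:
  fixes x :: real
  assumes "0 \<le> x" "x < 1"
  shows "ln ((1 + x) / (1 - x)) \<le> 2 * x / (1 - x\<^sup>2)"
proof -
  define h where "h x = 2 * x / (1 - x\<^sup>2) - ln ((1 + x) / (1 - x))" for x :: real
  have "h 0 \<le> h x"
  proof (rule DERIV_nonneg_imp_nondecreasing[OF assms(1)])
    fix y assume y: "0 \<le> y" "y \<le> x"
    with assms have y1: "y < 1" "y\<^sup>2 < 1" by (auto simp: power_less_one_iff)
    have "(h has_real_derivative (2 * (1 - y\<^sup>2) + 4 * y\<^sup>2) / (1 - y\<^sup>2)\<^sup>2 - 2 / (1 - y\<^sup>2)) (at y)"
    proof -
      have "((\<lambda>x. 2 * x / (1 - x\<^sup>2)) has_real_derivative (2 * (1 - y\<^sup>2) + 4 * y\<^sup>2) / (1 - y\<^sup>2)\<^sup>2) (at y)"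
        using y1 by (auto intro!: derivative_eq_intros simp: power2_eq_square)
      then show ?thesis
        unfolding h_def[abs_def] using y y1 by (intro DERIV_diff has_real_derivative_ln_ratio) auto
    qed
    moreover have "(2 * (1 - y\<^sup>2) + 4 * y\<^sup>2) / (1 - y\<^sup>2)\<^sup>2 - 2 / (1 - y\<^sup>2) = 4 * y\<^sup>2 / (1 - y\<^sup>2)\<^sup>2"
      using y1 by (simp add: divide_simps power2_eq_square)
    ultimately show "\<exists>D. (h has_real_derivative D) (at y) \<and> 0 \<le> D"
      by (intro exI conjI) auto
  qed
  then show ?thesis by (simp add: h_def)
qed

lemma ln_ratio_quotient_mono:
  fixes x r :: real
  assumes "0 < x" "x \<le> r" "r < 1"
  shows "ln ((1 + x) / (1 - x)) / x \<le> ln ((1 + r) / (1 - r)) / r"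
proof (rule DERIV_nonneg_imp_nondecreasing[where f = "\<lambda>x. ln ((1 + x) / (1 - x)) / x", OF assms(2)])
  fix y assume y: "x \<le> y" "y \<le> r"
  with assms have y1: "0 < y" "y < 1" by auto
  have "((\<lambda>x. ln ((1 + x) / (1 - x))) has_real_derivative 2 / (1 - y\<^sup>2)) (at y)"
    using y1 by (intro has_real_derivative_ln_ratio) auto
  from DERIV_divide[OF this DERIV_ident]
  have "((\<lambda>x. ln ((1 + x) / (1 - x)) / x) has_real_derivative
      (2 / (1 - y\<^sup>2) * y - ln ((1 + y) / (1 - y)) * 1) / (y * y)) (at y)"
    using y1 by auto
  moreover have "0 \<le> (2 / (1 - y\<^sup>2) * y - ln ((1 + y) / (1 - y)) * 1) / (y * y)"
    using ln_ratio_le[of y] y1 by simp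
  ultimately show "\<exists>D. ((\<lambda>x. ln ((1 + x) / (1 - x)) / x) has_real_derivative D) (at y) \<and> 0 \<le> D"
    by blast
qed

text \<open>For fixed \<open>z\<close> the gap \<open>g\<close> starts at
  \<open>g 0 = binary_deficit z\<close>. Its derivative at \<open>y\<close> is \<open>y\<close>
  times the increase of the quotient in \<open>ln_ratio_quotient_mono\<close> from \<open>y\<close>
  to the radius \<open>r\<close>.\<close>

lemma binary_deficit_superadditive_nonneg:
  assumes "0 \<le> x" "0 < z" "x\<^sup>2 + z\<^sup>2 \<le> 1"
  shows "binary_deficit x + binary_deficit z \<le> binary_deficit (sqrt (x\<^sup>2 + z\<^sup>2))"
proof -
  define g where "g y = binary_deficit (sqrt (y\<^sup>2 + z\<^sup>2)) - binary_deficit y" for y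
  have sq: "y\<^sup>2 + z\<^sup>2 \<le> 1" if "0 \<le> y" "y \<le> x" for y
    using power_mono[OF that(2,1), of 2] assms by simp
  have x1: "x \<le> 1" using assms zero_le_power2[of z] abs_square_le_1[of x] by linarith
  have "g 0 \<le> g x"
  \<comment> \<open>The open-interval version is used because the radius may equal 1 at
    \<open>y = x\<close>, where the deficit is continuous but not differentiable.\<close>
  proof (rule DERIV_nonneg_imp_increasing_open[OF assms(1)])
    fix y assume y: "0 < y" "y < x"
    define r where "r = sqrt (y\<^sup>2 + z\<^sup>2)"
    have yr: "y \<le> r" unfolding r_def using y by (intro real_le_rsqrt) simp
    have "y\<^sup>2 < x\<^sup>2" using y by (intro power_strict_mono) auto
    then have r1: "r < 1" unfolding r_def using assms by simp
    have z: "0 < y\<^sup>2 + z\<^sup>2" using y by (simp add: add_pos_nonneg)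
    have r: "((\<lambda>y. sqrt (y\<^sup>2 + z\<^sup>2)) has_real_derivative y / r) (at y)"
      using z unfolding r_def by (auto intro!: derivative_eq_intros simp: field_simps)
    have "((\<lambda>y. binary_deficit (sqrt (y\<^sup>2 + z\<^sup>2))) has_real_derivative ln ((1 + r) / (1 - r)) * (y / r)) (at y)"
      by (rule DERIV_chain2[OF _ r], fold r_def)
        (use yr r1 y in \<open>auto intro!: has_real_derivative_binary_deficit\<close>)
    then have "(g has_real_derivative ln ((1 + r) / (1 - r)) * (y / r) - ln ((1 + y) / (1 - y))) (at y)"
      unfolding g_def using yr r1 y
      by (intro DERIV_diff has_real_derivative_binary_deficit) auto
    moreover have "0 \<le> ln ((1 + r) / (1 - r)) * (y / r) - ln ((1 + y) / (1 - y))"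
      using mult_right_mono[OF ln_ratio_quotient_mono[OF y(1) yr r1], of y] y by simp
    ultimately show "\<exists>D. (g has_real_derivative D) (at y) \<and> 0 \<le> D" by blast
  next
    have "-1 \<le> sqrt (y\<^sup>2 + z\<^sup>2)" for y
      by (rule order_trans[of _ 0]) auto
    then show "continuous_on {0..x} g"
      unfolding g_def using x1
      by (intro continuous_intros continuous_on_compose2[OF continuous_on_binary_deficit])
        (use sq in auto)
  qed
  then show ?thesis using assms by (simp add: g_def binary_deficit_def)
qed

lemma binary_deficit_minus: "binary_deficit (- x) = binary_deficit x"
  by (simp add: binary_deficit_def)

lemma binary_deficit_abs: "binary_deficit \<bar>x\<bar> = binary_deficit x"
  by (simp add: abs_if binary_deficit_minus)

lemma binary_deficit_superadditive:
  assumes "x\<^sup>2 + z\<^sup>2 \<le> 1"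
  shows "binary_deficit x + binary_deficit z \<le> binary_deficit (sqrt (x\<^sup>2 + z\<^sup>2))"
proof (cases "z = 0")
  case True
  then show ?thesis by (simp add: binary_deficit_abs) (simp add: binary_deficit_def)
next
  case False
  then show ?thesis
    using binary_deficit_superadditive_nonneg[of "\<bar>x\<bar>" "\<bar>z\<bar>"] assms
    by (simp add: binary_deficit_abs)
qed

section \<open>Entropy inequality for one 2 by 2 block\<close>

lemma scaled_binary_deficit:
  assumes "0 < s" "\<bar>x\<bar> \<le> 1"
  shows "s * (1 + x) / 2 * ln (s * (1 + x) / 2) + s * (1 - x) / 2 * ln (s * (1 - x) / 2)
    = s / 2 * binary_deficit x + s * ln s - s * ln 2"
proof -
  \<comment> \<open>At \<open>u = 0\<close> the logarithm of the product does not split, but the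
    prefactor annihilates both sides.\<close>
  have "s * u / 2 * ln (s * u / 2) = s / 2 * (u * ln u + u * (ln s - ln 2))" if "0 \<le> u" for u
    using that assms by (cases "u = 0") (auto simp: ln_mult ln_div algebra_simps)
  from this[of "1 + x"] this[of "1 - x"] show ?thesis
    using assms unfolding binary_deficit_def by (simp only: abs_le_iff) argo
qed

text \<open>In nats, the right side is the coherence contributed by one block. Over blocks of traces
  \<open>1 - ez\<close> and \<open>ez\<close>, the terms \<open>- s * ln s\<close> add up to the
  binary entropy of \<open>ez\<close> and the terms \<open>s * ln 2\<close> to the constant 1 in
  \<open>K_six\<close>.\<close>

lemma block_entropy_inequality:
  assumes "0 \<le> a" "0 \<le> d" "k\<^sup>2 \<le> a * d"
  defines "s \<equiv> a + d"
  defines "R \<equiv> sqrt (((a - d) / 2)\<^sup>2 + k\<^sup>2)"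
  shows "(s / 2 + k) * ln (s / 2 + k) + (s / 2 - k) * ln (s / 2 - k) - s * ln s + s * ln 2
    \<le> (s / 2 + R) * ln (s / 2 + R) + (s / 2 - R) * ln (s / 2 - R) - a * ln a - d * ln d"
proof (cases "s = 0")
  case True
  then have "a = 0" "d = 0" using assms by auto
  then show ?thesis using assms by simp
next
  case False
  then have s: "0 < s" using assms by simp
  define x z where "x = 2 * k / s" and "z = (a - d) / s"
  have xz: "x\<^sup>2 + z\<^sup>2 \<le> 1"
  proof -
    \<comment> \<open>This is \<open>k\<^sup>2 \<le> a * d\<close> combined with
      \<open>s\<^sup>2 - (a - d)\<^sup>2 = 4 * a * d\<close>.\<close>
    have "4 * k\<^sup>2 + (a - d)\<^sup>2 \<le> s\<^sup>2"
      using assms by (simp add: power2_eq_square algebra_simps)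
    then show ?thesis using s
      by (simp add: x_def z_def power_divide power_mult_distrib flip: add_divide_distrib)
  qed
  have R: "2 * R / s = sqrt (x\<^sup>2 + z\<^sup>2)"
  proof -
    have "x\<^sup>2 + z\<^sup>2 = (2 / s)\<^sup>2 * (((a - d) / 2)\<^sup>2 + k\<^sup>2)"
      using s by (simp add: x_def z_def power_divide power2_eq_square add_divide_distrib distrib_left)
    then show ?thesis using s by (simp add: R_def real_sqrt_mult)
  qed
  have "x\<^sup>2 \<le> 1" "z\<^sup>2 \<le> 1"
    using xz zero_le_power2[of x] zero_le_power2[of z] by linarith+
  then have b: "\<bar>x\<bar> \<le> 1" "\<bar>z\<bar> \<le> 1" "\<bar>sqrt (x\<^sup>2 + z\<^sup>2)\<bar> \<le> 1"
    using xz by (simp_all add: abs_square_le_1)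
  have *: "s * (1 + x) / 2 = s / 2 + k" "s * (1 - x) / 2 = s / 2 - k"
    "s * (1 + z) / 2 = a" "s * (1 - z) / 2 = d"
    "s * (1 + sqrt (x\<^sup>2 + z\<^sup>2)) / 2 = s / 2 + R" "s * (1 - sqrt (x\<^sup>2 + z\<^sup>2)) / 2 = s / 2 - R"
    unfolding R[symmetric] using s by (simp_all add: x_def z_def s_def field_simps)
  \<comment> \<open>The terms \<open>s * ln s - s * ln 2\<close> cancel, leaving the superadditivity
    of the deficit multiplied by \<open>s / 2\<close>.\<close>
  show ?thesis
    using scaled_binary_deficit[OF s b(1)] scaled_binary_deficit[OF s b(2)]
      scaled_binary_deficit[OF s b(3)]
      mult_left_mono[OF binary_deficit_superadditive[OF xz], of "s / 2"] s
    unfolding * by (simp add: distrib_left)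
qed

section \<open>Von Neumann entropy from explicit diagonalizations\<close>

lemma mat_trace_comm:
  assumes "A \<in> carrier_mat n m" "B \<in> carrier_mat m n"
  shows "mat_trace (A * B) = mat_trace (B * A)"
proof -
  have "mat_trace (A * B) = (\<Sum>i<n. \<Sum>j<m. A $$ (i, j) * B $$ (j, i))"
    using assms unfolding mat_trace_def
    by (auto simp: scalar_prod_def lessThan_atLeast0 intro!: sum.cong)
  also have "\<dots> = (\<Sum>j<m. \<Sum>i<n. B $$ (j, i) * A $$ (i, j))"
    by (subst sum.swap) (simp add: mult.commute)
  also have "\<dots> = mat_trace (B * A)"
    using assms unfolding mat_trace_def
    by (auto simp: scalar_prod_def lessThan_atLeast0 intro!: sum.cong)
  finally show ?thesis .
qed

text \<open>The functional calculus diagonalizes the logarithm with the same \<open>U\<close>, and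
  cyclicity of the trace then removes \<open>U\<close>. Hence any explicit diagonalization
  determines the entropy.\<close>

lemma vn_entropy_diagonalization:
  assumes U: "unitary_mat n U"
    and A: "A = U * mat_diag n (\<lambda>i. complex_of_real (d i)) * mat_adjoint U"
  shows "vn_entropy A = - (\<Sum>i<n. d i * log 2 (d i))"
proof -
  let ?D = "mat_diag n (\<lambda>i. complex_of_real (d i))"
  let ?L = "mat_diag n (\<lambda>i. complex_of_real (log 2 (d i)))"
  have c: "U \<in> carrier_mat n n" "mat_adjoint U \<in> carrier_mat n n" and u: "mat_adjoint U * U = 1\<^sub>m n"
    using U mat_adjoint_carrier unfolding unitary_mat_def by auto
  have D: "?D \<in> carrier_mat n n" "?L \<in> carrier_mat n n" by simp_all
  have "dim_row A = n" using A c by simp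
  then have "spectral_form (log 2) A (U * ?L * mat_adjoint U)"
    using U A unfolding spectral_form_def by blast
  then have "A * mat_fun (log 2) A = U * ?D * mat_adjoint U * (U * ?L * mat_adjoint U)"
    using A mat_fun_eq by simp
  also have "\<dots> = U * (?D * (mat_adjoint U * U) * ?L * mat_adjoint U)"
    using c D by (simp add: assoc_mult_mat[of _ n n _ n _ n] mult_carrier_mat[of _ n n _ n])
  also have "mat_trace \<dots> = mat_trace (?D * (mat_adjoint U * U) * ?L * mat_adjoint U * U)"
    using c D by (intro mat_trace_comm[of _ n n] mult_carrier_mat[of _ n n _ n]) auto
  also have "\<dots> = mat_trace (?D * (mat_adjoint U * U) * ?L * (mat_adjoint U * U))"
    using c D by (simp add: assoc_mult_mat[of _ n n _ n _ n] mult_carrier_mat[of _ n n _ n])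
  also have "\<dots> = mat_trace (?D * ?L)"
    unfolding u using D c by (simp add: right_mult_one_mat[of _ n n] mult_carrier_mat[of _ n n _ n])
  also have "\<dots> = complex_of_real (\<Sum>i<n. d i * log 2 (d i))"
    by (simp add: mat_trace_def) (simp add: mat_diag_def)
  finally show ?thesis unfolding vn_entropy_def by simp
qed

text \<open>Taking \<open>((a - d) / 2, k)\<close> in polar coordinates with radius \<open>R\<close>
  and angle \<open>t\<close>, the rotation by \<open>t / 2\<close> diagonalizes the block, by the
  double-angle formulas. The case \<open>R = 0\<close> needs no separate treatment.\<close>

lemma symmetric_2x2_rotation:
  fixes a d k :: real
  defines "R \<equiv> sqrt (((a - d) / 2)\<^sup>2 + k\<^sup>2)"
  obtains c s where "c\<^sup>2 + s\<^sup>2 = 1"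
    "a = c\<^sup>2 * ((a + d) / 2 + R) + s\<^sup>2 * ((a + d) / 2 - R)"
    "d = s\<^sup>2 * ((a + d) / 2 + R) + c\<^sup>2 * ((a + d) / 2 - R)"
    "k = c * s * ((a + d) / 2 + R) - c * s * ((a + d) / 2 - R)"
proof -
  obtain r t where rt: "(a - d) / 2 = r * cos t" "k = r * sin t" "0 \<le> r"
    using rcis_cmod_Arg[of "Complex ((a - d) / 2) k"]
    by (intro that[of "cmod (Complex ((a - d) / 2) k)" "Arg (Complex ((a - d) / 2) k)"])
      (auto simp: complex_eq_iff)
  have "((a - d) / 2)\<^sup>2 + k\<^sup>2 = r\<^sup>2 * ((cos t)\<^sup>2 + (sin t)\<^sup>2)"
    unfolding rt by (simp only: power_mult_distrib distrib_left)
  then have R: "R = r" using rt(3) by (simp add: R_def)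
  define c s where "c = cos (t / 2)" and "s = sin (t / 2)"
  have cs: "c\<^sup>2 + s\<^sup>2 = 1" "cos t = c\<^sup>2 - s\<^sup>2" "sin t = 2 * s * c"
    using cos_double[of "t / 2"] sin_double[of "t / 2"] by (simp_all add: c_def s_def)
  have ad: "a = (a + d) / 2 + r * (c\<^sup>2 - s\<^sup>2)" "d = (a + d) / 2 - r * (c\<^sup>2 - s\<^sup>2)"
    using rt(1) cs(2) by (simp_all add: field_simps)
  have "c\<^sup>2 * (u + r) + s\<^sup>2 * (u - r) = (c\<^sup>2 + s\<^sup>2) * u + r * (c\<^sup>2 - s\<^sup>2)"
    "s\<^sup>2 * (u + r) + c\<^sup>2 * (u - r) = (c\<^sup>2 + s\<^sup>2) * u - r * (c\<^sup>2 - s\<^sup>2)" for u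
    by (simp_all add: algebra_simps)
  moreover have "k = c * s * (u + r) - c * s * (u - r)" for u
    unfolding rt cs by (simp add: algebra_simps)
  ultimately show ?thesis
    using that[of c s] cs(1) ad unfolding R by simp
qed

lemma mat_adjoint_index:
  assumes "U \<in> carrier_mat n m" "i < m" "j < n"
  shows "mat_adjoint U $$ (i, j) = cnj (U $$ (j, i))"
  using assms by (simp add: mat_adjoint_def mat_of_rows_def)

lemma vn_entropy_mat_diag:
  "vn_entropy (mat_diag n (\<lambda>i. complex_of_real (d i))) = - (\<Sum>i<n. d i * log 2 (d i))"
proof (rule vn_entropy_diagonalization)
  have "mat_adjoint (1\<^sub>m n) = (1\<^sub>m n :: complex mat)"
    using mat_adjoint_carrier[of "1\<^sub>m n" n]
    by (intro eq_matI) (auto simp: mat_adjoint_index[of _ n n])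
  then show "unitary_mat n (1\<^sub>m n)"
    "mat_diag n (\<lambda>i. complex_of_real (d i)) = 1\<^sub>m n * mat_diag n (\<lambda>i. complex_of_real (d i)) * mat_adjoint (1\<^sub>m n)"
    by (simp_all add: unitary_mat_def right_mult_one_mat[of _ n n] left_mult_one_mat[of _ n n])
qed

text \<open>The matrix is a direct sum of blocks on the indices 0, 3 and 1, 2, each diagonalized by
  its own rotation.\<close>

lemma vn_entropy_x_matrix:
  assumes M: "M = mat_of_rows_list 4 (map (map complex_of_real)
      [[a, 0, 0, k], [0, b, l, 0], [0, l, c, 0], [k, 0, 0, d]])"
  defines "R \<equiv> sqrt (((a - d) / 2)\<^sup>2 + k\<^sup>2)" and "T \<equiv> sqrt (((b - c) / 2)\<^sup>2 + l\<^sup>2)"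
  defines "ev \<equiv> \<lambda>i::nat. [(a + d) / 2 + R, (b + c) / 2 + T, (b + c) / 2 - T, (a + d) / 2 - R] ! i"
  shows "vn_entropy M = - (\<Sum>i<4. ev i * log 2 (ev i))"
proof -
  obtain x y where xy: "x\<^sup>2 + y\<^sup>2 = 1"
    "a = x\<^sup>2 * ((a + d) / 2 + R) + y\<^sup>2 * ((a + d) / 2 - R)"
    "d = y\<^sup>2 * ((a + d) / 2 + R) + x\<^sup>2 * ((a + d) / 2 - R)"
    "k = x * y * ((a + d) / 2 + R) - x * y * ((a + d) / 2 - R)"
    unfolding R_def by (rule symmetric_2x2_rotation)
  obtain u v where uv: "u\<^sup>2 + v\<^sup>2 = 1"
    "b = u\<^sup>2 * ((b + c) / 2 + T) + v\<^sup>2 * ((b + c) / 2 - T)"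
    "c = v\<^sup>2 * ((b + c) / 2 + T) + u\<^sup>2 * ((b + c) / 2 - T)"
    "l = u * v * ((b + c) / 2 + T) - u * v * ((b + c) / 2 - T)"
    unfolding T_def by (rule symmetric_2x2_rotation)
  \<comment> \<open>Column \<open>i\<close> of \<open>U\<close> is an eigenvector for
    \<open>ev i\<close>. The transpose \<open>V\<close> is written out so that products can be
    computed entrywise.\<close>
  define U where "U = mat_of_rows_list 4 (map (map complex_of_real)
    [[x, 0, 0, - y], [0, u, - v, 0], [0, v, u, 0], [y, 0, 0, x]])"
  define V where "V = mat_of_rows_list 4 (map (map complex_of_real)
    [[x, 0, 0, y], [0, u, v, 0], [0, - v, u, 0], [- y, 0, 0, x]])"
  have U: "U \<in> carrier_mat 4 4" and V: "V \<in> carrier_mat 4 4"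
    by (auto simp: U_def V_def mat_of_rows_list_def)
  have adj: "mat_adjoint U = V"
    by (rule eq_matI)
      (auto simp: mat_adjoint_index[OF U] carrier_matD[OF V] less_4_cases,
       auto simp: U_def V_def mat_of_rows_list_def mat_adjoint_def)
  have UV: "(U * mat_diag 4 f * V) $$ (i, j) = (\<Sum>m<4. U $$ (i, m) * f m * V $$ (m, j))"
    if "i < 4" "j < 4" for f i j
    using U V that unfolding mat_diag_mult_right[OF U]
    by (simp add: scalar_prod_def lessThan_atLeast0)
  have n1: "x * x + y * y = 1" "u * u + v * v = 1" "y * y + x * x = 1" "v * v + u * u = 1"
    using xy(1) uv(1) by (simp_all add: power2_eq_square)
  have "V * U = 1\<^sub>m 4" "U * V = 1\<^sub>m 4"
    by (rule eq_matI; use U V in \<open>auto simp: less_4_cases scalar_prod_def sum4 simp flip: lessThan_atLeast0\<close>;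
        auto simp: U_def V_def mat_of_rows_list_def n1 simp flip: of_real_mult of_real_add)+
  then have "unitary_mat 4 U"
    using U by (simp add: unitary_mat_def adj)
  moreover have "M = U * mat_diag 4 (\<lambda>i. complex_of_real (ev i)) * mat_adjoint U"
  proof (rule eq_matI)
    have e: "ev 0 = (a + d) / 2 + R" "ev 1 = (b + c) / 2 + T" "ev 2 = (b + c) / 2 - T" "ev 3 = (a + d) / 2 - R"
      by (simp_all add: ev_def)
    \<comment> \<open>The factors are ordered as in the entries of the product; \<open>k\<close> and
      \<open>l\<close> each appear twice, once for each side of the diagonal.\<close>
    have abcd: "a = x * ev 0 * x + y * ev 3 * y" "d = y * ev 0 * y + x * ev 3 * x"
      "k = x * ev 0 * y - y * ev 3 * x" "k = y * ev 0 * x - x * ev 3 * y"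
      "b = u * ev 1 * u + v * ev 2 * v" "c = v * ev 1 * v + u * ev 2 * u"
      "l = u * ev 1 * v - v * ev 2 * u" "l = v * ev 1 * u - u * ev 2 * v"
      unfolding e using xy uv by (simp_all add: power2_eq_square mult_ac)
    fix i j assume "i < dim_row (U * mat_diag 4 (\<lambda>i. complex_of_real (ev i)) * mat_adjoint U)"
      "j < dim_col (U * mat_diag 4 (\<lambda>i. complex_of_real (ev i)) * mat_adjoint U)"
    then have ij: "i < 4" "j < 4" using U V by (auto simp: adj)
    show "M $$ (i, j) = (U * mat_diag 4 (\<lambda>i. complex_of_real (ev i)) * mat_adjoint U) $$ (i, j)"
      using ij unfolding adj UV[OF ij] sum4 unfolding less_4_cases
      by (auto simp: M U_def V_def mat_of_rows_list_def simp flip: of_real_mult of_real_add of_real_minus of_real_diff)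
        (rule abcd[unfolded One_nat_def])+
  qed (use U V in \<open>auto simp: M adj mat_of_rows_list_def\<close>)
  ultimately show ?thesis by (rule vn_entropy_diagonalization)
qed

section \<open>Positivity of the blocks and comparison of the rates\<close>

lemma nonneg_quadratic_form:
  fixes a d k :: real
  assumes "\<And>x y. 0 \<le> a * x\<^sup>2 + 2 * k * x * y + d * y\<^sup>2"
  shows "0 \<le> a" "0 \<le> d" "k\<^sup>2 \<le> a * d"
proof -
  show "0 \<le> a" using assms[of 1 0] by simp
  show d: "0 \<le> d" using assms[of 0 1] by simp
  show "k\<^sup>2 \<le> a * d"
  proof (cases "d = 0")
    case True
    \<comment> \<open>Without the \<open>y\<^sup>2\<close> term, \<open>y = a + 1\<close> is large
      enough for the mixed term to outweigh \<open>a * k\<^sup>2\<close>.\<close>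
    have "0 \<le> - (k\<^sup>2 * (a + 2))"
      using assms[of "- k" "a + 1"] True by (simp add: power2_eq_square algebra_simps)
    then have "k\<^sup>2 \<le> 0"
      using \<open>0 \<le> a\<close> by (simp add: mult_le_0_iff)
    then show ?thesis using True by simp
  next
    case False
    \<comment> \<open>For \<open>x = d\<close> the form is minimal at \<open>y = - k\<close>, where
      its value is \<open>d\<close> times the determinant.\<close>
    have "0 \<le> d * (a * d - k\<^sup>2)"
      using assms[of d "- k"] by (simp add: power2_eq_square algebra_simps)
    then show ?thesis using d False by (simp add: zero_le_mult_iff)
  qed
qed

lemma sum_log2_mult_ln2:
  "(\<Sum>i\<in>A. f i * log 2 (f i)) * ln 2 = (\<Sum>i\<in>A. f i * ln (f i))"
  by (simp add: sum_distrib_right log_def)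

theorem corollary4:
  fixes \<rho> :: "complex mat" and m00 m11 m22 m33 ex ey ez :: real and p :: "nat \<Rightarrow> real"
  assumes "density_mat 4 \<rho>"
    and "complex_of_real m00 = \<rho> $$ (0, 0)"
    and "complex_of_real m11 = \<rho> $$ (1, 1)"
    and "complex_of_real m22 = \<rho> $$ (2, 2)"
    and "complex_of_real m33 = \<rho> $$ (3, 3)"
    and "complex_of_real ex = mat_trace (Pi_x_minus * \<rho>)"
    and "complex_of_real ey = mat_trace (Pi_y_minus * \<rho>)"
    and "ez = m11 + m22"
    and "(\<Sum>i<4. p i) = 1" and "ex = p 1 + p 3" and "ey = p 1 + p 2" and "ez = p 2 + p 3"
  shows "K_six_opt m00 m11 m22 m33 ex ey ez \<ge> K_six p"
proof -
  define k l where "k = (1 - ex - ey) / 2" and "l = (ey - ex) / 2"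
  have \<rho>: "\<rho> \<in> carrier_mat 4 4" and "mat_trace \<rho> = 1"
    using assms(1) unfolding density_mat_def hermitian_mat_def by auto
  then have "complex_of_real (m00 + m11 + m22 + m33) = 1"
    unfolding mat_trace_def using assms(2-5) by (simp add: sum4)
  then have tr: "m00 + m33 = 1 - ez"
    unfolding of_real_eq_1_iff using assms(8) by simp
  have pos: "0 \<le> Re (\<Sum>i<4. \<Sum>j<4. \<rho> $$ (i, j) * xs ! j * cnj (xs ! i))" if "length xs = 4" for xs
    using assms(1) expect_list[OF \<rho> that] carrier_vecI[of "vec_of_list xs" 4] that
    unfolding density_mat_def by (metis dim_vec_of_list)
  \<comment> \<open>Solving the linear equations pairs \<open>p 0\<close>, \<open>p 1\<close> with
    the outer block and \<open>p 2\<close>, \<open>p 3\<close> with the inner one, in the form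
    required by \<open>block_entropy_inequality\<close>.\<close>
  have p: "p 0 = (m00 + m33) / 2 + k" "p 1 = (m00 + m33) / 2 - k"
    "p 2 = (m11 + m22) / 2 + l" "p 3 = (m11 + m22) / 2 - l"
    using assms(8-12) tr unfolding sum4 k_def l_def by argo+

  define c where "c = inverse (complex_of_real (sqrt 2))"
  have cc: "c * (c * z) = z / 2" "c * (z * c) = z / 2" "cnj c = c" for z
    using half arg_cong[OF half, of "\<lambda>x. x * z"] unfolding c_def by (simp_all add: mult_ac)
  have bell_expect: "complex_of_real (p i) = (\<Sum>j<4. \<Sum>m<4. \<rho> $$ (j, m) * xs ! m * cnj (xs ! j))"
    if "bell_vec i = vec_of_list xs" "length xs = 4" "i < 4" for i xs
    using bell_diagonal[OF assms(1,3,4,6-12) that(3)] expect_list[OF \<rho> that(2)] that(1) by simp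
  have b: "bell_vec 0 = vec_of_list [c, 0, 0, c]" "bell_vec 1 = vec_of_list [c, 0, 0, -c]"
    "bell_vec 2 = vec_of_list [0, c, c, 0]" "bell_vec 3 = vec_of_list [0, c, -c, 0]"
    using bell[of 0] bell[of 1] bell[of 2] bell[of 3] unfolding c_def by simp_all
  \<comment> \<open>Subtracting the two Bell expectations cancels the diagonal entries and isolates
    the coherences.\<close>
  have "complex_of_real (p 0) - complex_of_real (p 1) = \<rho> $$ (0, 3) + \<rho> $$ (3, 0)"
    using bell_expect[OF b(1)] bell_expect[OF b(2)]
    by (simp add: sum4 cc mult_ac)
  then have "complex_of_real (2 * k) = \<rho> $$ (0, 3) + \<rho> $$ (3, 0)"
    unfolding p by simp
  then have k: "2 * k = Re (\<rho> $$ (0, 3)) + Re (\<rho> $$ (3, 0))"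
    by (metis Re_complex_of_real plus_complex.sel(1))
  have "complex_of_real (p 2) - complex_of_real (p 3) = \<rho> $$ (1, 2) + \<rho> $$ (2, 1)"
    using bell_expect[OF b(3)] bell_expect[OF b(4)]
    by (simp add: sum4 cc mult_ac)
  then have "complex_of_real (2 * l) = \<rho> $$ (1, 2) + \<rho> $$ (2, 1)"
    unfolding p by simp
  then have l: "2 * l = Re (\<rho> $$ (1, 2)) + Re (\<rho> $$ (2, 1))"
    by (metis Re_complex_of_real plus_complex.sel(1))

  have diag: "Re (\<rho> $$ (0, 0)) = m00" "Re (\<rho> $$ (1, 1)) = m11"
    "Re (\<rho> $$ (2, 2)) = m22" "Re (\<rho> $$ (3, 3)) = m33"
    unfolding assms(2-5)[symmetric] by simp_all
  \<comment> \<open>On real combinations of the basis vectors 0 and 3, only the real parts of the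
    coherences enter, and these sum to \<open>2 * k\<close>. Positivity of \<open>\<rho>\<close>
    thus passes to the outer block of \<open>tau\<close>.\<close>
  have "0 \<le> m00 * x\<^sup>2 + 2 * k * x * y + m33 * y\<^sup>2" for x y
    unfolding k using pos[of "[complex_of_real x, 0, 0, complex_of_real y]"]
    by (simp add: sum4 diag[unfolded One_nat_def] power2_eq_square algebra_simps)
  note outer = nonneg_quadratic_form[OF this]
  have "0 \<le> m11 * x\<^sup>2 + 2 * l * x * y + m22 * y\<^sup>2" for x y
    unfolding l using pos[of "[0, complex_of_real x, complex_of_real y, 0]"]
    by (simp add: sum4 diag[unfolded One_nat_def] power2_eq_square algebra_simps)
  note inner = nonneg_quadratic_form[OF this]

  let ?\<tau> = "tau m00 m11 m22 m33 ex ey"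
  define R T where "R = sqrt (((m00 - m33) / 2)\<^sup>2 + k\<^sup>2)" and "T = sqrt (((m11 - m22) / 2)\<^sup>2 + l\<^sup>2)"
  have S: "- vn_entropy ?\<tau> * ln 2 =
      ((m00 + m33) / 2 + R) * ln ((m00 + m33) / 2 + R) + ((m00 + m33) / 2 - R) * ln ((m00 + m33) / 2 - R)
    + ((m11 + m22) / 2 + T) * ln ((m11 + m22) / 2 + T) + ((m11 + m22) / 2 - T) * ln ((m11 + m22) / 2 - T)"
    unfolding vn_entropy_x_matrix[OF tau_def] k_def[symmetric] l_def[symmetric]
      R_def[symmetric] T_def[symmetric] minus_minus sum_log2_mult_ln2
    by (simp add: sum4)
  have "diag_part ?\<tau> = mat_diag 4 (\<lambda>i. complex_of_real ([m00, m11, m22, m33] ! i))"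
    by (rule eq_matI) (auto simp: diag_part_def tau_def mat_of_rows_list_def mat_diag_def less_4_cases)
  then have D: "vn_entropy (diag_part ?\<tau>) * ln 2 =
      - (m00 * ln m00 + m11 * ln m11 + m22 * ln m22 + m33 * ln m33)"
    by (simp only: vn_entropy_mat_diag mult_minus_left sum_log2_mult_ln2) (simp add: sum4)
  have H: "binary_entropy ez * ln 2 = - ez * ln ez - (1 - ez) * ln (1 - ez)"
    by (simp add: binary_entropy_def log_def field_simps)
  have K: "K_six p * ln 2 = ln 2 + p 0 * ln (p 0) + p 1 * ln (p 1) + p 2 * ln (p 2) + p 3 * ln (p 3)"
    by (simp add: K_six_def shannon_entropy_def distrib_right sum_log2_mult_ln2) (simp add: sum4)
  \<comment> \<open>In nats, this is the sum of the block inequalities for the outer and inner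
    blocks.\<close>
  have "K_six p * ln 2 \<le> K_six_opt m00 m11 m22 m33 ex ey ez * ln 2"
    unfolding K_six_opt_def coherence_def left_diff_distrib H D
    using S K block_entropy_inequality[OF outer] block_entropy_inequality[OF inner]
    unfolding p[symmetric] R_def[symmetric] T_def[symmetric] unfolding tr assms(8)[symmetric]
    by (simp add: left_diff_distrib)
  then show ?thesis by simp
qed

end
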